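(* Let $G$ be a digraph and let $v\in V(G)$ be a dismantlable vertex. Then the inclusion $G\setminus\{v\}\to G$ is a bihomotopy equivalence.
   Context: A digraph $G$ consists of a finite vertex set $V(G)$ and an edge set $E(G)\subseteq V(G)\times V(G)$ (loops are allowed, and $(v,w)$ and $(w,v)$ may both be edges). Write $\overrightarrow{N}_G(v)=\{w:(v,w)\in E(G)\}$ and $\overleftarrow{N}_G(v)=\{w:(w,v)\in E(G)\}$. A vertex $v$ of $G$ is dismantlable if there is a vertex $w\ne v$ with $\overleftarrow{N}_G(v)\subseteq\overleftarrow{N}_G(w)$ and $\overrightarrow{N}_G(v)\subseteq\overrightarrow{N}_G(w)$. $G\setminus\{v\}$ is the subgraph induced on $V(G)\setminus\{v\}$. A multihomomorphism from $G$ to $H$ is a map $\alpha: V(G)\to 2^{V(H)}\setminus\{\emptyset\}$ such that $\alpha(v)\times\alpha(w)\subseteq E(H)$ for every $(v,w)\in E(G)$. $\overrightarrow{\mathrm{Hom}}(G,H)$ is the polyhedral subcomplex of $\prod_{x\in V(G)}\Delta^{V(H)}$ (where $\Delta^{S}$ is the simplex with vertex set $S$) whose cells are the products $\prod_{x}\Delta^{\alpha(x)}$ over all multihomomorphisms $\alpha$; its vertices are the homomorphisms $G\to H$. Homomorphisms $f,g:G\to H$ are bihomotopic if there is a path between them in $\overrightarrow{\mathrm{Hom}}(G,H)$. A homomorphism $f:G\to H$ is a bihomotopy equivalence if there is a homomorphism $g:H\to G$ with $g\circ f$ bihomotopic to $\mathrm{id}_G$ and $f\circ g$ bihomotopic to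 $\mathrm{id}_H$. *)

theory Defs
  imports "HOL-Analysis.Analysis" "Graph_Theory.Pair_Digraph"
begin

definition out_nbhd :: "'a pair_pre_digraph \<Rightarrow> 'a \<Rightarrow> 'a set" where
  "out_nbhd G v = {w. (v, w) \<in> parcs G}"

definition in_nbhd :: "'a pair_pre_digraph \<Rightarrow> 'a \<Rightarrow> 'a set" where
  "in_nbhd G v = {w. (w, v) \<in> parcs G}"

definition dismantlable :: "'a pair_pre_digraph \<Rightarrow> 'a \<Rightarrow> bool" where
  "dismantlable G v \<longleftrightarrow> v \<in> pverts G \<and>
     (\<exists>w\<in>pverts G. w \<noteq> v \<and> in_nbhd G v \<subseteq> in_nbhd G w \<and> out_nbhd G v \<subseteq> out_nbhd G w)"

definition delete_vertex :: "'a pair_pre_digraph \<Rightarrow> 'a \<Rightarrow> 'a pair_pre_digraph" where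
  "delete_vertex G v =
     \<lparr>pverts = pverts G - {v},
      parcs = parcs G \<inter> (pverts G - {v}) \<times> (pverts G - {v})\<rparr>"

text \<open>Homomorphisms and multihomomorphisms are encoded as total functions, of which only
  the values on the vertices of the source matter.\<close>

definition dhom :: "'a pair_pre_digraph \<Rightarrow> 'b pair_pre_digraph \<Rightarrow> ('a \<Rightarrow> 'b) \<Rightarrow> bool" where
  "dhom G H f \<longleftrightarrow> f \<in> pverts G \<rightarrow> pverts H \<and> (\<forall>(x, y)\<in>parcs G. (f x, f y) \<in> parcs H)"

definition multihom :: "'a pair_pre_digraph \<Rightarrow> 'b pair_pre_digraph \<Rightarrow> ('a \<Rightarrow> 'b set) \<Rightarrow> bool" where
  "multihom G H \<alpha> \<longleftrightarrow>
     \<alpha> \<in> pverts G \<rightarrow> Pow (pverts H) - {{}} \<and> (\<forall>(x, y)\<in>parcs G. \<alpha> x \<times> \<alpha> y \<subseteq> parcs H)"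

text \<open>Points of the simplex with vertex set \<open>W\<close> are given by barycentric coordinates, as
  extensional functions on \<open>W\<close>. The face spanned by \<open>S \<subseteq> W\<close> is kept inside the
  coordinate space of \<open>W\<close>, so that all cells of the Hom complex lie in one ambient space.\<close>

definition simplex_face :: "'b set \<Rightarrow> 'b set \<Rightarrow> ('b \<Rightarrow> real) set" where
  "simplex_face W S =
     {t \<in> extensional W. (\<forall>w\<in>W. 0 \<le> t w) \<and> (\<forall>w\<in>W - S. t w = 0) \<and> (\<Sum>w\<in>W. t w) = 1}"

definition simplex_topology :: "'b set \<Rightarrow> ('b \<Rightarrow> real) topology" where
  "simplex_topology W = subtopology (powertop_real W) (simplex_face W W)"

definition hom_cell ::
  "'a pair_pre_digraph \<Rightarrow> 'b pair_pre_digraph \<Rightarrow> ('a \<Rightarrow> 'b set) \<Rightarrow> ('a \<Rightarrow> 'b \<Rightarrow> real) set" where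
  "hom_cell G H \<alpha> = (\<Pi>\<^sub>E x\<in>pverts G. simplex_face (pverts H) (\<alpha> x))"

definition hom_complex ::
  "'a pair_pre_digraph \<Rightarrow> 'b pair_pre_digraph \<Rightarrow> ('a \<Rightarrow> 'b \<Rightarrow> real) topology" where
  "hom_complex G H =
     subtopology (product_topology (\<lambda>x. simplex_topology (pverts H)) (pverts G))
       (\<Union>\<alpha>\<in>Collect (multihom G H). hom_cell G H \<alpha>)"

definition hom_vertex ::
  "'a pair_pre_digraph \<Rightarrow> 'b pair_pre_digraph \<Rightarrow> ('a \<Rightarrow> 'b) \<Rightarrow> 'a \<Rightarrow> 'b \<Rightarrow> real" where
  "hom_vertex G H f = (\<lambda>x\<in>pverts G. \<lambda>y\<in>pverts H. if y = f x then 1 else 0)"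

definition bihomotopic ::
  "'a pair_pre_digraph \<Rightarrow> 'b pair_pre_digraph \<Rightarrow> ('a \<Rightarrow> 'b) \<Rightarrow> ('a \<Rightarrow> 'b) \<Rightarrow> bool" where
  "bihomotopic G H f g \<longleftrightarrow> dhom G H f \<and> dhom G H g \<and>
     path_component_of (hom_complex G H) (hom_vertex G H f) (hom_vertex G H g)"

definition bihomotopy_equivalence ::
  "'a pair_pre_digraph \<Rightarrow> 'b pair_pre_digraph \<Rightarrow> ('a \<Rightarrow> 'b) \<Rightarrow> bool" where
  "bihomotopy_equivalence G H f \<longleftrightarrow> dhom G H f \<and>
     (\<exists>g. dhom H G g \<and> bihomotopic G G (g \<circ> f) id \<and> bihomotopic H H (f \<circ> g) id)"

end

theory Submission
  imports Defs
begin

text \<open>Let \<open>w\<close> witness that \<open>v\<close> is dismantlable, and let \<open>r\<close> be the retraction of \<open>G\<close> onto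
  \<open>G \<setminus> {v}\<close> that sends \<open>v\<close> to \<open>w\<close> and fixes every other vertex. It is a homotopy inverse of
  the inclusion. One composite is the identity on \<open>G \<setminus> {v}\<close> outright. For the other, the
  neighbourhood inclusions say that \<open>v\<close> may be replaced by \<open>w\<close> at either end of an arc
  (lemma \<open>dismantlable_replacement\<close>), so \<open>x \<mapsto> {r x, x}\<close> is a multihomomorphism from \<open>G\<close> to
  itself. The vertices \<open>r\<close> and \<open>id\<close> of the Hom complex then lie in one common cell, and since a
  cell is convex the straight segment joins them (lemma \<open>bihomotopic_if_common_cell\<close>).\<close>

definition hom_segment ::
  "'a pair_pre_digraph \<Rightarrow> 'b pair_pre_digraph \<Rightarrow> ('a \<Rightarrow> 'b) \<Rightarrow> ('a \<Rightarrow> 'b) \<Rightarrow> real \<Rightarrow> 'a \<Rightarrow> 'b \<Rightarrow> real"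
  where
  "hom_segment G H f g t =
     (\<lambda>x\<in>pverts G. \<lambda>y\<in>pverts H. (1 - t) * indicator {f x} y + t * indicator {g x} y)"

lemma simplex_face_mono: "S \<subseteq> T \<Longrightarrow> simplex_face W S \<subseteq> simplex_face W T"
  by (auto simp: simplex_face_def)

lemma segment_in_simplex_face:
  fixes t :: real
  assumes "finite W" "a \<in> W" "b \<in> W" "t \<in> {0..1}"
  shows "(\<lambda>y\<in>W. (1 - t) * indicator {a} y + t * indicator {b} y) \<in> simplex_face W {a, b}"
proof -
  have "(\<Sum>y\<in>W. (1 - t) * indicator {a} y + t * indicator {b} y) =
        (1 - t) * (\<Sum>y\<in>W. indicator {a} y) + t * (\<Sum>y\<in>W. indicator {b} y)"
    by (simp add: sum.distrib sum_distrib_left)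
  also have "\<dots> = 1"
    using assms by (simp add: indicator_def)
  finally show ?thesis
    using assms by (auto simp: simplex_face_def)
qed

lemma hom_segment_in_cell:
  assumes "finite (pverts H)" "multihom G H (\<lambda>x. {f x, g x})" "t \<in> {0..1}"
  shows "hom_segment G H f g t \<in> hom_cell G H (\<lambda>x. {f x, g x})"
  unfolding hom_segment_def hom_cell_def
proof (rule restrict_PiE_iff[THEN iffD2], rule ballI)
  fix x assume "x \<in> pverts G"
  with assms(2) have "f x \<in> pverts H" "g x \<in> pverts H"
    by (auto simp: multihom_def Pi_iff)
  with assms show "(\<lambda>y\<in>pverts H. (1 - t) * indicator {f x} y + t * indicator {g x} y)
      \<in> simplex_face (pverts H) {f x, g x}"
    by (intro segment_in_simplex_face)
qed

text \<open>All topologies involved are subspaces of products of lines, so a coordinatewise affine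
  path is continuous as soon as it stays inside the complex.\<close>

lemma pathin_hom_segment:
  assumes "finite (pverts H)" "multihom G H (\<lambda>x. {f x, g x})"
  shows "pathin (hom_complex G H) (hom_segment G H f g)"
proof -
  let ?I = "top_of_set {0..1::real}"
  have cell: "hom_segment G H f g t \<in> hom_cell G H (\<lambda>x. {f x, g x})" if "t \<in> {0..1}" for t
    using hom_segment_in_cell[OF assms that] .
  have coord: "continuous_map ?I (simplex_topology (pverts H)) (\<lambda>t. hom_segment G H f g t x)"
    if x: "x \<in> pverts G" for x
    unfolding simplex_topology_def
  proof (intro continuous_map_into_subtopology)
    show "continuous_map ?I (powertop_real (pverts H)) (\<lambda>t. hom_segment G H f g t x)"
      using x by (auto simp: continuous_map_componentwise hom_segment_def
          intro!: continuous_intros)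
    show "(\<lambda>t. hom_segment G H f g t x) \<in> topspace ?I \<rightarrow> simplex_face (pverts H) (pverts H)"
    proof
      fix t :: real assume "t \<in> topspace ?I"
      then have "hom_segment G H f g t x \<in> simplex_face (pverts H) {f x, g x}"
        using cell[of t] x by (auto simp: hom_cell_def)
      moreover have "{f x, g x} \<subseteq> pverts H"
        using assms(2) x by (auto simp: multihom_def Pi_iff)
      ultimately show "hom_segment G H f g t x \<in> simplex_face (pverts H) (pverts H)"
        using simplex_face_mono by blast
    qed
  qed
  show ?thesis
    unfolding pathin_def hom_complex_def
  proof (intro continuous_map_into_subtopology)
    show "continuous_map ?I (product_topology (\<lambda>x. simplex_topology (pverts H)) (pverts G))
            (hom_segment G H f g)"
      using coord by (auto simp: continuous_map_componentwise hom_segment_def)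
    show "hom_segment G H f g \<in> topspace ?I \<rightarrow> (\<Union>\<alpha>\<in>Collect (multihom G H). hom_cell G H \<alpha>)"
      using cell assms(2) by (auto intro!: bexI[of _ "\<lambda>x. {f x, g x}"])
  qed
qed

text \<open>The multihomomorphism \<open>x \<mapsto> {f x, g x}\<close> spans a cell having both \<open>f\<close> and \<open>g\<close> as vertices,
  and that cell contains the segment between them. Taking \<open>f\<close> and \<open>g\<close> to agree on the vertices
  gives reflexivity up to irrelevant values.\<close>

lemma bihomotopic_if_common_cell:
  assumes "finite (pverts H)" "multihom G H (\<lambda>x. {f x, g x})"
  shows "bihomotopic G H f g"
proof -
  have "dhom G H f" "dhom G H g"
    using assms(2) by (auto simp: multihom_def dhom_def Pi_iff)
  moreover have "hom_segment G H f g 0 = hom_vertex G H f"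
    "hom_segment G H f g 1 = hom_vertex G H g"
    by (auto simp: hom_segment_def hom_vertex_def indicator_def fun_eq_iff)
  ultimately show ?thesis
    using pathin_hom_segment[OF assms] unfolding bihomotopic_def path_component_of_def by blast
qed

text \<open>Replace the two ends of the arc one after the other. After the first replacement the pair is
  again an arc, so the second inclusion applies to it; this also covers a loop at \<open>v\<close>, where
  both ends move.\<close>

lemma dismantlable_replacement:
  assumes "in_nbhd G v \<subseteq> in_nbhd G w" "out_nbhd G v \<subseteq> out_nbhd G w"
    and "(x, y) \<in> parcs G" "a \<in> {(id(v := w)) x, x}" "b \<in> {(id(v := w)) y, y}"
  shows "(a, b) \<in> parcs G"
proof -
  have "(a, y) \<in> parcs G"
    using assms by (auto simp: out_nbhd_def split: if_splits)
  then show ?thesis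
    using assms by (auto simp: in_nbhd_def split: if_splits)
qed

theorem lemma6p4:
  fixes G :: "'a pair_pre_digraph" and v :: 'a
  assumes "pair_fin_digraph G"
    and "dismantlable G v"
  shows "bihomotopy_equivalence (delete_vertex G v) G (\<lambda>x. x)"
proof -
  interpret pair_fin_digraph G by fact
  obtain w where w: "w \<in> pverts G" "w \<noteq> v"
    and nbhds: "in_nbhd G v \<subseteq> in_nbhd G w" "out_nbhd G v \<subseteq> out_nbhd G w"
    using assms(2) by (auto simp: dismantlable_def)
  define r where "r = id(v := w)"
  let ?D = "delete_vertex G v"
  have arcs: "(a, b) \<in> parcs G" if "(x, y) \<in> parcs G" "a \<in> {r x, x}" "b \<in> {r y, y}" for x y a b
    using dismantlable_replacement[OF nbhds] that unfolding r_def by blast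
  have r_verts: "r x \<in> pverts G - {v}" if "x \<in> pverts G" for x
    using that w by (auto simp: r_def)
  have incl: "dhom ?D G (\<lambda>x. x)"
    by (auto simp: dhom_def delete_vertex_def)
  have retr: "dhom G ?D r"
    unfolding dhom_def
  proof (intro conjI ballI)
    show "r \<in> pverts G \<rightarrow> pverts ?D"
      using r_verts by (simp add: delete_vertex_def)
    fix e assume e: "e \<in> parcs G"
    obtain x y where xy: "e = (x, y)" by force
    have "x \<in> pverts G" "y \<in> pverts G"
      using arc_fst_in_verts[OF e] arc_snd_in_verts[OF e] xy by auto
    then show "case e of (x, y) \<Rightarrow> (r x, r y) \<in> parcs ?D"
      using arcs[of x y "r x" "r y"] r_verts[of x] r_verts[of y] e xy
      by (simp add: delete_vertex_def)
  qed
  have "multihom ?D ?D (\<lambda>x. {(r \<circ> (\<lambda>x. x)) x, id x})"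
    by (auto simp: multihom_def delete_vertex_def r_def)
  moreover have "finite (pverts ?D)"
    by (simp add: delete_vertex_def)
  ultimately have "bihomotopic ?D ?D (r \<circ> (\<lambda>x. x)) id"
    by (rule bihomotopic_if_common_cell[rotated])
  moreover have "multihom G G (\<lambda>x. {((\<lambda>x. x) \<circ> r) x, id x})"
    unfolding multihom_def
  proof (intro conjI ballI)
    show "(\<lambda>x. {((\<lambda>x. x) \<circ> r) x, id x}) \<in> pverts G \<rightarrow> Pow (pverts G) - {{}}"
      using r_verts by auto
    fix e assume "e \<in> parcs G"
    moreover obtain x y where "e = (x, y)" by force
    ultimately show "case e of (x, y) \<Rightarrow>
        {((\<lambda>x. x) \<circ> r) x, id x} \<times> {((\<lambda>x. x) \<circ> r) y, id y} \<subseteq> parcs G"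
      using arcs[of x y] by auto
  qed
  then have "bihomotopic G G ((\<lambda>x. x) \<circ> r) id"
    by (intro bihomotopic_if_common_cell) simp_all
  ultimately show ?thesis
    using incl retr unfolding bihomotopy_equivalence_def by blast
qed

end
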